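(* Let $F$ be a forest. Then $i(F)=d(\overline F)$. If moreover $\overline F$ is spherical, then $\gamma(F)=d(\overline F)$.
   Context: $i(F)$ is the minimum size of an independent dominating set and $\gamma(F)$ the minimum size of a dominating set of $F$. For a graph $G$ on vertex set $X=\{x_1,\dots,x_n\}$, the edge ideal $\overline G\subset\mathbb{Z}[X]$ is generated by $x_1^2,\ldots,x_n^2$ and $x_ix_j$ for each edge $\{x_i,x_j\}$. For a monomial ideal $I$ containing all $x_i^2$: $R(I)$ is the simplicial complex of monomials not in $I$; $(I:x)=\{m:xm\in I\}$; $R(I)$ is a cone with apex $a\in X$ if $(I:a)=(I,a)$ (i.e. $a$ divides no minimal monomial generator of $I$ other than the $x_i^2$); $a$ dominates $b$ in $I$ if $R(I)$ is not a cone with apex $b$ but $R((I,a))$ is a cone with apex $b$. A sequence $A=(a_1,\ldots,a_r)$ of variables, with $I_i=(I:a_1\cdots a_{i-1})$, is a resolution of $I$ if for all $i\in[r]$, $a_i\notin I_i$ and either $R(I_i)$ is a cone with apex $a_i$ or $a_i$ dominates some $b_i$ in $I_i$. It is maximal if it cannot be extended to a longer resolution; its depth is $r$; $d(I)$ is the minimum depth of a maximal resolution of $I$. $A$ is spherical if $R(I_i)$ is not a cone with apex $a_i$ for every $i\in[r]$; $I$ is spherical if it admits a spherical maximal resolution. *)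

theory Defs
  imports "HOL-Algebra.Ideal" "HOL-Library.Poly_Mapping"
begin

section \<open>Finite simple graphs\<close>

definition simple_graph :: "'a set \<Rightarrow> 'a set set \<Rightarrow> bool" where
  "simple_graph V E \<longleftrightarrow> finite V \<and> (\<forall>e\<in>E. e \<subseteq> V \<and> card e = 2)"

text \<open>A cycle is given by its cyclic list of at least three distinct vertices. (The forest
  predicate of the AFP digraph library is about directed cycles: on a symmetric digraph it
  counts every edge, traversed back and forth, as a cycle.)\<close>

definition is_cycle :: "'a set set \<Rightarrow> 'a list \<Rightarrow> bool" where
  "is_cycle E c \<longleftrightarrow> length c \<ge> 3 \<and> distinct c \<and>
     (\<forall>i<length c. {c ! i, c ! (Suc i mod length c)} \<in> E)"

definition forest :: "'a set \<Rightarrow> 'a set set \<Rightarrow> bool" where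
  "forest V E \<longleftrightarrow> simple_graph V E \<and> (\<nexists>c. is_cycle E c)"

definition independent_set :: "'a set \<Rightarrow> 'a set set \<Rightarrow> 'a set \<Rightarrow> bool" where
  "independent_set V E S \<longleftrightarrow> S \<subseteq> V \<and> (\<forall>u\<in>S. \<forall>v\<in>S. {u, v} \<notin> E)"

definition dominating_set :: "'a set \<Rightarrow> 'a set set \<Rightarrow> 'a set \<Rightarrow> bool" where
  "dominating_set V E S \<longleftrightarrow> S \<subseteq> V \<and> (\<forall>v\<in>V - S. \<exists>u\<in>S. {u, v} \<in> E)"

definition domination_number :: "'a set \<Rightarrow> 'a set set \<Rightarrow> nat" where
  "domination_number V E = (LEAST k. \<exists>S. dominating_set V E S \<and> card S = k)"

definition independent_domination_number :: "'a set \<Rightarrow> 'a set set \<Rightarrow> nat" where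
  "independent_domination_number V E =
     (LEAST k. \<exists>S. independent_set V E S \<and> dominating_set V E S \<and> card S = k)"

section \<open>The polynomial ring \<open>\<int>[X]\<close> and edge ideals\<close>

text \<open>A monomial is its finitely supported exponent function; a polynomial is a finitely supported
  function from monomials to coefficients, with the convolution product of
  \<^theory>\<open>HOL-Library.Poly_Mapping\<close>.\<close>

type_synonym 'a int_mpoly = "('a \<Rightarrow>\<^sub>0 nat) \<Rightarrow>\<^sub>0 int"

definition var :: "'a \<Rightarrow> 'a int_mpoly" where
  "var x = Poly_Mapping.single (Poly_Mapping.single x 1) 1"

definition mpoly_ring :: "'a set \<Rightarrow> 'a int_mpoly ring" where
  "mpoly_ring X =
     \<lparr>carrier = {p. \<forall>m\<in>Poly_Mapping.keys p. Poly_Mapping.keys m \<subseteq> X},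
      mult = (*), one = 1, zero = 0, add = (+)\<rparr>"

definition edge_ideal :: "'a set \<Rightarrow> 'a set set \<Rightarrow> 'a int_mpoly set" where
  "edge_ideal V E = Idl\<^bsub>mpoly_ring V\<^esub>
     ({(var x)\<^sup>2 | x. x \<in> V} \<union> {var x * var y | x y. {x, y} \<in> E})"

section \<open>Resolutions\<close>

text \<open>The ideals \<open>(I : q)\<close> and \<open>(I, a)\<close> of \<open>\<int>[X]\<close>.\<close>

definition colon :: "'a set \<Rightarrow> 'a int_mpoly set \<Rightarrow> 'a int_mpoly \<Rightarrow> 'a int_mpoly set" where
  "colon X I q = {p \<in> carrier (mpoly_ring X). q * p \<in> I}"

definition adjoin :: "'a set \<Rightarrow> 'a int_mpoly set \<Rightarrow> 'a \<Rightarrow> 'a int_mpoly set" where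
  "adjoin X I a = Idl\<^bsub>mpoly_ring X\<^esub> (I \<union> {var a})"

text \<open>The complex \<open>R(I)\<close> of the monomials outside \<open>I\<close> is a cone with apex \<open>a\<close>; this is
  by definition a property of the ideal \<open>I\<close>.\<close>

definition cone_apex :: "'a set \<Rightarrow> 'a int_mpoly set \<Rightarrow> 'a \<Rightarrow> bool" where
  "cone_apex X I a \<longleftrightarrow> a \<in> X \<and> colon X I (var a) = adjoin X I a"

definition dominates :: "'a set \<Rightarrow> 'a int_mpoly set \<Rightarrow> 'a \<Rightarrow> 'a \<Rightarrow> bool" where
  "dominates X I a b \<longleftrightarrow>
     a \<in> X \<and> b \<in> X \<and> \<not> cone_apex X I b \<and> cone_apex X (adjoin X I a) b"

text \<open>Lists are indexed from 0, so \<open>colon_seq X I A i\<close> is the ideal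
  \<open>I\<^sub>i\<^sub>+\<^sub>1 = (I : a\<^sub>1 \<cdots> a\<^sub>i)\<close> and \<open>A ! i\<close> is \<open>a\<^sub>i\<^sub>+\<^sub>1\<close>.\<close>

definition colon_seq :: "'a set \<Rightarrow> 'a int_mpoly set \<Rightarrow> 'a list \<Rightarrow> nat \<Rightarrow> 'a int_mpoly set" where
  "colon_seq X I A i = colon X I (\<Prod>j<i. var (A ! j))"

definition resolution :: "'a set \<Rightarrow> 'a int_mpoly set \<Rightarrow> 'a list \<Rightarrow> bool" where
  "resolution X I A \<longleftrightarrow> set A \<subseteq> X \<and>
     (\<forall>i<length A. var (A ! i) \<notin> colon_seq X I A i \<and>
        (cone_apex X (colon_seq X I A i) (A ! i) \<or>
         (\<exists>b. dominates X (colon_seq X I A i) (A ! i) b)))"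

definition maximal_resolution :: "'a set \<Rightarrow> 'a int_mpoly set \<Rightarrow> 'a list \<Rightarrow> bool" where
  "maximal_resolution X I A \<longleftrightarrow>
     resolution X I A \<and> (\<nexists>B. B \<noteq> [] \<and> resolution X I (A @ B))"

definition min_depth :: "'a set \<Rightarrow> 'a int_mpoly set \<Rightarrow> nat" where
  "min_depth X I = (LEAST r. \<exists>A. maximal_resolution X I A \<and> length A = r)"

definition spherical_resolution :: "'a set \<Rightarrow> 'a int_mpoly set \<Rightarrow> 'a list \<Rightarrow> bool" where
  "spherical_resolution X I A \<longleftrightarrow>
     resolution X I A \<and> (\<forall>i<length A. \<not> cone_apex X (colon_seq X I A i) (A ! i))"

definition spherical :: "'a set \<Rightarrow> 'a int_mpoly set \<Rightarrow> bool" where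
  "spherical X I \<longleftrightarrow> (\<exists>A. maximal_resolution X I A \<and> spherical_resolution X I A)"

section \<open>The ideals are ideals of the commutative ring \<open>\<int>[X]\<close>\<close>

lemma keys_mult_subset:
  assumes "p \<in> carrier (mpoly_ring X)" "q \<in> carrier (mpoly_ring X)"
  shows "p * q \<in> carrier (mpoly_ring X)"
proof -
  have "Poly_Mapping.keys m \<subseteq> X" if "m \<in> Poly_Mapping.keys (p * q)" for m
  proof -
    from that keys_mult[of p q] obtain a b where
      "m = a + b" "a \<in> Poly_Mapping.keys p" "b \<in> Poly_Mapping.keys q" by blast
    with assms Poly_Mapping.keys_add[of a b] show ?thesis
      by (fastforce simp: mpoly_ring_def)
  qed
  then show ?thesis by (simp add: mpoly_ring_def)
qed

lemma cring_mpoly_ring: "cring (mpoly_ring X)"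
proof (rule cringI)
  show "abelian_group (mpoly_ring X)"
  proof (rule abelian_groupI)
    fix p q assume "p \<in> carrier (mpoly_ring X)" "q \<in> carrier (mpoly_ring X)"
    then show "p \<oplus>\<^bsub>mpoly_ring X\<^esub> q \<in> carrier (mpoly_ring X)"
      using Poly_Mapping.keys_add[of p q] by (fastforce simp: mpoly_ring_def)
  next
    fix p assume "p \<in> carrier (mpoly_ring X)"
    then show "\<exists>q\<in>carrier (mpoly_ring X). q \<oplus>\<^bsub>mpoly_ring X\<^esub> p = \<zero>\<^bsub>mpoly_ring X\<^esub>"
      by (intro bexI[of _ "- p"]) (auto simp: mpoly_ring_def)
  qed (auto simp: mpoly_ring_def algebra_simps)
  show "comm_monoid (mpoly_ring X)"
  proof (rule comm_monoidI)
    fix p q assume "p \<in> carrier (mpoly_ring X)" "q \<in> carrier (mpoly_ring X)"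
    then show "p \<otimes>\<^bsub>mpoly_ring X\<^esub> q \<in> carrier (mpoly_ring X)"
      using keys_mult_subset[of p X q] by (simp add: mpoly_ring_def)
  qed (auto simp: mpoly_ring_def algebra_simps)
qed (auto simp: mpoly_ring_def algebra_simps)

lemma var_in_carrier: "x \<in> X \<Longrightarrow> var x \<in> carrier (mpoly_ring X)"
  by (simp add: mpoly_ring_def var_def)

lemma ideal_edge_ideal:
  assumes "simple_graph V E"
  shows "ideal (edge_ideal V E) (mpoly_ring V)"
proof -
  interpret cring "mpoly_ring V" by (rule cring_mpoly_ring)
  show ?thesis unfolding edge_ideal_def
  proof (rule genideal_ideal)
    have "x \<in> V \<and> y \<in> V" if "{x, y} \<in> E" for x y
      using that assms by (auto simp: simple_graph_def)
    then show "{(var x)\<^sup>2 | x. x \<in> V} \<union> {var x * var y | x y. {x, y} \<in> E} \<subseteq> carrier (mpoly_ring V)"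
      by (auto simp: power2_eq_square intro!: keys_mult_subset var_in_carrier)
  qed
qed

end

theory Submission
  imports Defs
begin

text \<open>Every ideal \<open>I\<^sub>i\<close> of a resolution is the edge ideal of an induced subgraph \<open>F[W]\<close> together with the
  variables outside \<open>W\<close>. The next element \<open>a\<close> is either an isolated vertex of \<open>F[W]\<close> (the cone case)
  or a neighbour of a leaf of \<open>F[W]\<close> (the domination case, called a support below), and it replaces
  \<open>W\<close> by \<open>W - N[a]\<close>. In a forest the process stops only at \<open>W = {}\<close>, so maximal resolutions are
  independent dominating sets, whence \<open>i(F) \<le> d\<close>.

  Conversely, let \<open>D\<close> be an independent dominating set. If it contains an isolated vertex or a support,
  take that vertex. Otherwise take the second vertex \<open>a\<close> of a longest path: \<open>W - N[a]\<close>
  has an independent dominating set smaller than \<open>D\<close>. By induction \<open>d \<le> i(F)\<close>.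

  If there is a spherical maximal resolution, then by confluence every choice of supports leads to one
  of the same length. Choosing the second vertex of a longest path again, the same reduction
  applied to a merely dominating set \<open>D\<close> shows that this length is at most \<open>|D|\<close>, so \<open>d \<le> \<gamma>(F) \<le> i(F)\<close>.\<close>

subsection \<open>Leaves and supports in forests\<close>

definition nbrs :: "'a set set \<Rightarrow> 'a set \<Rightarrow> 'a \<Rightarrow> 'a set" where
  "nbrs E W v = {u \<in> W. {u, v} \<in> E}"

definition del_nbhd :: "'a set set \<Rightarrow> 'a set \<Rightarrow> 'a \<Rightarrow> 'a set" where
  "del_nbhd E W a = W - insert a (nbrs E W a)"

definition isolated :: "'a set set \<Rightarrow> 'a set \<Rightarrow> 'a \<Rightarrow> bool" where
  "isolated E W a \<longleftrightarrow> a \<in> W \<and> nbrs E W a = {}"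

definition leaf_at :: "'a set set \<Rightarrow> 'a set \<Rightarrow> 'a \<Rightarrow> 'a \<Rightarrow> bool" where
  "leaf_at E W b a \<longleftrightarrow> b \<in> W \<and> nbrs E W b = {a}"

definition support :: "'a set set \<Rightarrow> 'a set \<Rightarrow> 'a \<Rightarrow> bool" where
  "support E W a \<longleftrightarrow> (\<exists>b. leaf_at E W b a)"

lemma del_nbhd_subset: "del_nbhd E W a \<subseteq> W"
  by (auto simp: del_nbhd_def)

lemma mem_del_nbhd: "x \<in> del_nbhd E W a \<longleftrightarrow> x \<in> W \<and> x \<noteq> a \<and> {x, a} \<notin> E"
  by (auto simp: del_nbhd_def nbrs_def)

lemma del_nbhd_commute: "del_nbhd E (del_nbhd E W a) b = del_nbhd E (del_nbhd E W b) a"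
  by (auto simp: mem_del_nbhd)

lemma leaf_atD:
  assumes "leaf_at E W b a"
  shows "b \<in> W" "a \<in> W" "{a, b} \<in> E" "{b, a} \<in> E" "\<And>x. x \<in> W \<Longrightarrow> {x, b} \<in> E \<Longrightarrow> x = a"
    "\<And>x. x \<in> W \<Longrightarrow> {b, x} \<in> E \<Longrightarrow> x = a"
proof -
  have b: "b \<in> W" and n: "x \<in> W \<and> {x, b} \<in> E \<longleftrightarrow> x = a" for x
    using assms by (auto simp: leaf_at_def nbrs_def)
  show "b \<in> W" "a \<in> W" "{a, b} \<in> E" "{b, a} \<in> E" using b n[of a] by (simp_all add: insert_commute)
  show "x = a" if "x \<in> W" "{x, b} \<in> E" for x using n that by blast
  then show "x = a" if "x \<in> W" "{b, x} \<in> E" for x using that by (simp add: insert_commute)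
qed

lemma support_mem: "support E W a \<Longrightarrow> a \<in> W"
  by (auto simp: support_def dest: leaf_atD)

lemma isolated_not_support:
  assumes "isolated E W a" shows "\<not> support E W a"
proof
  assume "support E W a"
  then obtain b where b: "leaf_at E W b a" by (auto simp: support_def)
  then have "b \<in> nbrs E W a" using leaf_atD(1,4)[OF b] by (simp add: nbrs_def)
  then show False using assms by (simp add: isolated_def)
qed

lemma forest_no_loop: "forest V E \<Longrightarrow> {x} \<notin> E"
  by (auto simp: forest_def simple_graph_def)

text \<open>The first vertex of a longest path in \<open>W\<close> has degree at most 1: a neighbour
  other than its successor would either prolong the path or lie on it and close a cycle.\<close>

lemma forest_low_degree:
  assumes "forest V E" "W \<subseteq> V" "W \<noteq> {}"
  obtains v c where "v \<in> W" "nbrs E W v \<subseteq> {c}"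
proof -
  have "\<exists>v\<in>W. \<exists>c. nbrs E W v \<subseteq> {c}"
  proof (rule ccontr)
    assume "\<not> ?thesis"
    then have two: "\<exists>u\<in>W. {u, v} \<in> E \<and> u \<noteq> c" if "v \<in> W" for v c
      using that by (fastforce simp: nbrs_def)
    have finW: "finite W"
      using assms by (auto simp: forest_def simple_graph_def dest: finite_subset)
    define path where "path xs \<longleftrightarrow> xs \<noteq> [] \<and> distinct xs \<and> set xs \<subseteq> W \<and>
      (\<forall>i. Suc i < length xs \<longrightarrow> {xs ! i, xs ! Suc i} \<in> E)" for xs
    obtain w where "w \<in> W" using assms by blast
    then have "path [w]" by (simp add: path_def)
    moreover have "length xs < Suc (card W)" if "path xs" for xs
      using that card_mono[OF finW, of "set xs"] distinct_card[of xs] by (auto simp: path_def)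
    ultimately obtain xs where xs: "path xs" and max: "\<And>ys. path ys \<Longrightarrow> length ys \<le> length xs"
      using ex_has_greatest_nat[of path "[w]" length "Suc (card W)"] by blast
    have "xs ! 0 \<in> W" using xs by (cases xs) (auto simp: path_def)
    \<comment> \<open>For a path of a single vertex \<open>xs ! 1\<close> is an unspecified value.
      This is harmless, as \<open>two\<close> avoids any prescribed \<open>c\<close>.\<close>
    then obtain u where u: "u \<in> W" "{u, xs ! 0} \<in> E" "u \<noteq> xs ! 1"
      using two by blast
    have "u \<in> set xs"
    proof (rule ccontr)
      assume "u \<notin> set xs"
      then have "path (u # xs)"
        using u xs unfolding path_def by (auto simp: nth_Cons split: nat.split)
      then show False using max by fastforce
    qed
    then obtain j where j: "j < length xs" "u = xs ! j" by (auto simp: in_set_conv_nth)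
    have "j \<noteq> 0" using u j forest_no_loop[OF assms(1)] by (auto intro: gr0I)
    moreover have "j \<noteq> 1" using u j by auto
    ultimately have "j \<ge> 2" by linarith
    \<comment> \<open>The edge from \<open>u\<close> to the first vertex closes the segment up to
      \<open>u\<close>; \<open>j \<ge> 2\<close> makes it long enough.\<close>
    have "is_cycle E (take (Suc j) xs)"
      unfolding is_cycle_def
    proof (intro conjI allI impI)
      show "3 \<le> length (take (Suc j) xs)" using j \<open>j \<ge> 2\<close> by simp
      show "distinct (take (Suc j) xs)" using xs by (simp add: path_def)
      fix i assume i: "i < length (take (Suc j) xs)"
      show "{take (Suc j) xs ! i, take (Suc j) xs ! (Suc i mod length (take (Suc j) xs))} \<in> E"
      proof (cases "i = j")
        case True then show ?thesis using j u by simp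
      next
        case False
        then have "i < j" using i by simp
        then show ?thesis using j xs by (auto simp: path_def)
      qed
    qed
    then show False using assms(1) by (auto simp: forest_def)
  qed
  then show thesis using that by blast
qed

text \<open>The vertex \<open>a\<close> plays the role of the second vertex of a longest path, \<open>c\<close> of the third and
  \<open>p\<close> of the fourth: peel off the leaves twice and apply the existence of vertices of low degree.\<close>

lemma forest_deep_support:
  assumes F: "forest V E" and WV: "W \<subseteq> V" and ne: "W \<noteq> {}" and iso: "\<And>v. \<not> isolated E W v"
  obtains a c p where "support E W a"
    "\<And>x. x \<in> nbrs E W a \<Longrightarrow> leaf_at E W x a \<or> x = c"
    "\<And>x. x \<in> nbrs E W c \<Longrightarrow> x = p \<or> leaf_at E W x c \<or> support E W x"
proof -
  define W1 where "W1 = {v \<in> W. \<forall>u. \<not> leaf_at E W v u}"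
  define W2 where "W2 = {v \<in> W1. \<forall>c. \<not> nbrs E W1 v \<subseteq> {c}}"
  have leaf: "\<exists>u. leaf_at E W v u" if "v \<in> W" "v \<notin> W1" for v
    using that by (auto simp: W1_def)
  have leaf_nbr: "leaf_at E W x v" if "x \<in> nbrs E W v" "x \<notin> W1" "v \<in> W" for x v
  proof -
    have x: "x \<in> W" "{x, v} \<in> E" using that by (auto simp: nbrs_def)
    then obtain u where u: "leaf_at E W x u" using leaf \<open>x \<notin> W1\<close> by blast
    moreover have "v = u" using leaf_atD(6)[OF u \<open>v \<in> W\<close>] x by blast
    ultimately show ?thesis by simp
  qed
  \<comment> \<open>Such a \<open>v\<close> has at most one neighbour in \<open>W1\<close> but at
    least two in \<open>W\<close>, so some neighbour is a leaf.\<close>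
  have supp: "support E W v" if v: "v \<in> W1" "v \<notin> W2" for v
  proof -
    obtain c where c: "nbrs E W1 v \<subseteq> {c}" using v by (auto simp: W2_def)
    have "v \<in> W" using v by (auto simp: W1_def)
    have "nbrs E W v \<noteq> {c}" "nbrs E W v \<noteq> {}"
      using v iso[of v] by (auto simp: W1_def leaf_at_def isolated_def)
    then obtain x where "x \<in> nbrs E W v" "x \<noteq> c" by blast
    moreover from this have "x \<notin> W1" using c by (auto simp: nbrs_def)
    ultimately show ?thesis using leaf_nbr \<open>v \<in> W\<close> by (auto simp: support_def)
  qed
  have nbr: "x \<in> W1 \<or> leaf_at E W x v" if "x \<in> nbrs E W v" "v \<in> W" for x v
    using leaf_nbr that by blast
  consider "W1 = {}" | "W1 \<noteq> {}" "W2 = {}" | "W2 \<noteq> {}" by blast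
  then show thesis
  proof cases
    case 1
    obtain v where "v \<in> W" using ne by blast
    then obtain a where a: "leaf_at E W v a" using leaf 1 by blast
    then have "a \<in> W" by (rule leaf_atD)
    \<comment> \<open>All neighbours are leaves here, so \<open>c\<close> and \<open>p\<close> are
      arbitrary fillers.\<close>
    show thesis
    proof (rule that[of a v v])
      show "support E W a" using a by (auto simp: support_def)
      show "leaf_at E W x a \<or> x = v" if "x \<in> nbrs E W a" for x
        using nbr[OF that \<open>a \<in> W\<close>] 1 by blast
      show "x = v \<or> leaf_at E W x v \<or> support E W x" if "x \<in> nbrs E W v" for x
        using nbr[OF that \<open>v \<in> W\<close>] 1 by blast
    qed
  next
    case 2
    then obtain a where a: "a \<in> W1" by blast
    then have "a \<in> W" by (auto simp: W1_def)
    obtain c0 where c0: "nbrs E W1 a \<subseteq> {c0}" using a 2 by (auto simp: W2_def)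
    show thesis
    proof (cases "nbrs E W1 a = {}")
      case True
      obtain b where b: "leaf_at E W b a" using supp a 2 by (auto simp: support_def)
      \<comment> \<open>With no neighbour of \<open>a\<close> in \<open>W1\<close>, any leaf
        \<open>b\<close> can serve as \<open>c\<close>, and its only neighbour \<open>a\<close> as
        \<open>p\<close>.\<close>
      show thesis
      proof (rule that[of a b a])
        show "support E W a" using b by (auto simp: support_def)
        show "leaf_at E W x a \<or> x = b" if "x \<in> nbrs E W a" for x
          using nbr[OF that \<open>a \<in> W\<close>] True that by (auto simp: nbrs_def)
        show "x = a \<or> leaf_at E W x b \<or> support E W x" if "x \<in> nbrs E W b" for x
          using that b by (auto simp: leaf_at_def)
      qed
    next
      case False
      then have c: "c0 \<in> W1" using c0 by (auto simp: nbrs_def)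
      then have "c0 \<in> W" by (auto simp: W1_def)
      show thesis
      proof (rule that[of a c0 a])
        show "support E W a" using supp a 2 by blast
        show "leaf_at E W x a \<or> x = c0" if "x \<in> nbrs E W a" for x
          using nbr[OF that \<open>a \<in> W\<close>] c0 that by (auto simp: nbrs_def)
        show "x = a \<or> leaf_at E W x c0 \<or> support E W x" if "x \<in> nbrs E W c0" for x
          using nbr[OF that \<open>c0 \<in> W\<close>] supp 2 by blast
      qed
    qed
  next
    case 3
    have "W2 \<subseteq> V" using WV by (auto simp: W1_def W2_def)
    then obtain c p where c: "c \<in> W2" "nbrs E W2 c \<subseteq> {p}"
      using forest_low_degree[OF F _ 3] by blast
    then have cW: "c \<in> W" "c \<in> W1" by (auto simp: W1_def W2_def)
    \<comment> \<open>In \<open>W1\<close> the vertex \<open>c\<close> has a neighbour other than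
      \<open>p\<close>, but in \<open>W2\<close> it has at most \<open>p\<close>. So a neighbour
      \<open>a\<close> was dropped from \<open>W1\<close>, and \<open>c\<close> is the only
      neighbour of \<open>a\<close> in \<open>W1\<close>.\<close>
    from c obtain a where a: "a \<in> nbrs E W1 c" "a \<noteq> p" by (auto simp: W2_def)
    then have a1: "a \<in> W1" "a \<notin> W2" "a \<in> W" using c(2) by (auto simp: nbrs_def W1_def)
    then obtain c' where c': "nbrs E W1 a \<subseteq> {c'}" by (auto simp: W2_def)
    have "c' = c" using c' a cW by (auto simp: nbrs_def insert_commute)
    show thesis
    proof (rule that[of a c p])
      show "support E W a" using supp a1 by blast
      show "leaf_at E W x a \<or> x = c" if "x \<in> nbrs E W a" for x
        using nbr[OF that \<open>a \<in> W\<close>] c' \<open>c' = c\<close> that by (auto simp: nbrs_def)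
      show "x = p \<or> leaf_at E W x c \<or> support E W x" if "x \<in> nbrs E W c" for x
        using nbr[OF that \<open>c \<in> W\<close>] supp c(2) that by (auto simp: nbrs_def)
    qed
  qed
qed

text \<open>Removing \<open>D \<inter> N[a]\<close> from \<open>D\<close> can leave only \<open>p\<close> undominated, and then both \<open>c\<close> and one of \<open>a\<close> and
  its leaves were removed, so that adding \<open>p\<close> still makes the set smaller.\<close>

lemma forest_reduce_dominating:
  assumes F: "forest V E" and WV: "W \<subseteq> V" and ne: "W \<noteq> {}" and iso: "\<And>v. \<not> isolated E W v"
    and D: "dominating_set W E D"
    and bad: "\<And>a c x. support E W a \<Longrightarrow> c \<in> nbrs E W a \<Longrightarrow> c \<in> D \<Longrightarrow> leaf_at E W x c \<Longrightarrow> x = a"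
  obtains a D' where "support E W a" "dominating_set (del_nbhd E W a) E D'" "card D' < card D"
    "independent_set W E D \<Longrightarrow> independent_set (del_nbhd E W a) E D'"
proof -
  obtain a c p where a: "support E W a"
    and nba: "\<And>x. x \<in> nbrs E W a \<Longrightarrow> leaf_at E W x a \<or> x = c"
    and nbc: "\<And>x. x \<in> nbrs E W c \<Longrightarrow> x = p \<or> leaf_at E W x c \<or> support E W x"
    using forest_deep_support[OF F WV ne iso] by metis
  obtain b where b: "leaf_at E W b a" using a by (auto simp: support_def)
  have "finite W" using F WV by (auto simp: forest_def simple_graph_def dest: finite_subset)
  have DW: "D \<subseteq> W" using D by (auto simp: dominating_set_def)
  then have finD: "finite D" using \<open>finite W\<close> finite_subset by blast
  have dom: "\<exists>d\<in>D. d = x \<or> {d, x} \<in> E" if "x \<in> W" for x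
    using D that by (auto simp: dominating_set_def)
  have ab: "a \<in> D \<or> b \<in> D"
    using dom[OF leaf_atD(1)[OF b]] leaf_atD(5)[OF b] DW by blast
  define W' where "W' = del_nbhd E W a"
  define D0 where "D0 = D \<inter> W'"
  \<comment> \<open>The lost dominator \<open>d\<close> of \<open>x\<close> lies in N[a]. It is
    neither \<open>a\<close>, which is not adjacent to \<open>x\<close>, nor a leaf at
    \<open>a\<close>, which has no neighbour but \<open>a\<close>; so it is
    \<open>c\<close>.\<close>
  have lost: "c \<in> nbrs E W a \<and> c \<in> D \<and> {c, x} \<in> E \<and> x = p"
    if x: "x \<in> W'" and undom: "\<And>d. d \<in> D0 \<Longrightarrow> d \<noteq> x \<and> {d, x} \<notin> E" for x
  proof -
    have xW: "x \<in> W" "x \<noteq> a" "{x, a} \<notin> E" using x by (auto simp: W'_def mem_del_nbhd)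
    obtain d where d: "d \<in> D" "d = x \<or> {d, x} \<in> E" using dom xW by blast
    then have "d \<notin> W'" using undom by (auto simp: D0_def)
    then have "d = a \<or> d \<in> nbrs E W a" using d DW by (auto simp: W'_def del_nbhd_def)
    moreover have "d \<noteq> x" using \<open>d \<notin> W'\<close> x by blast
    ultimately have dn: "d \<in> nbrs E W a" and dx: "{d, x} \<in> E"
      using d xW by (auto simp: insert_commute)
    have "\<not> leaf_at E W d a" using leaf_atD(6)[of E W d a x] dx xW by blast
    then have "d = c" using nba dn by blast
    have xc: "x \<in> nbrs E W c" using dx xW \<open>d = c\<close> by (auto simp: nbrs_def insert_commute)
    \<comment> \<open>A leaf of \<open>c\<close> would be stranded once \<open>c\<close> is gone;
      \<open>bad\<close> rules this out.\<close>
    have "\<not> leaf_at E W x c" using bad[OF a] dn d xW \<open>d = c\<close> by blast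
    \<comment> \<open>A leaf \<open>l\<close> of \<open>x\<close> survives, and \<open>D\<close>
      needs \<open>l\<close> or \<open>x\<close> to dominate it; either one would lie in
      \<open>D0\<close> and dominate \<open>x\<close>.\<close>
    moreover have "\<not> support E W x"
    proof
      assume "support E W x"
      then obtain l where l: "leaf_at E W l x" by (auto simp: support_def)
      have lW: "l \<in> W'"
        using leaf_atD(1,3)[OF l] leaf_atD(6)[OF l, of a] xW leaf_atD(2)[OF b] by (auto simp: W'_def mem_del_nbhd)
      obtain e where e: "e \<in> D" "e = l \<or> {e, l} \<in> E" using dom leaf_atD(1)[OF l] by blast
      then have "e = l \<or> e = x" using leaf_atD(5)[OF l] DW by blast
      then show False
        using undom[of l] undom[of x] e lW x leaf_atD(4)[OF l] by (auto simp: D0_def)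
    qed
    ultimately show ?thesis using nbc[OF xc] dn dx d \<open>d = c\<close> by blast
  qed
  have indep: "{u, v} \<notin> E" if "independent_set W E D" "u \<in> D" "v \<in> D" for u v
    using that by (auto simp: independent_set_def)
  have D0: "D0 \<subseteq> D" "D0 \<subseteq> W'" "a \<notin> D0" "b \<notin> D0" "finite D0"
    using leaf_atD(4)[OF b] finD by (auto simp: D0_def W'_def mem_del_nbhd)
  show thesis
  proof (cases "p \<in> W' \<and> (\<forall>d\<in>D0. d \<noteq> p \<and> {d, p} \<notin> E)")
    case False
    show thesis
    proof (rule that[OF a, of D0])
      show "dominating_set (del_nbhd E W a) E D0"
        unfolding dominating_set_def W'_def[symmetric]
      proof (intro conjI ballI)
        show "D0 \<subseteq> W'" using D0 by blast
        show "\<exists>u\<in>D0. {u, v} \<in> E" if "v \<in> W' - D0" for v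
          using lost[of v] False that by blast
      qed
      show "card D0 < card D"
        using D0 ab finD by (intro psubset_card_mono) blast+
      show "independent_set (del_nbhd E W a) E D0" if "independent_set W E D"
        unfolding independent_set_def using D0 indep[OF that] by (fold W'_def) blast
    qed
  next
    case True
    then have c: "c \<in> nbrs E W a" "c \<in> D" "{c, p} \<in> E" using lost by blast+
    have "c \<noteq> a" using c forest_no_loop[OF F] by (auto simp: nbrs_def)
    have "c \<notin> D0" using c by (auto simp: D0_def W'_def mem_del_nbhd nbrs_def)
    have "c \<noteq> b"
      using True c leaf_atD(6)[OF b, of p] by (auto simp: W'_def mem_del_nbhd)
    obtain e where e: "e \<in> {a, b}" "e \<in> D" using ab by blast
    show thesis
    proof (rule that[OF a, of "insert p D0"])
      show "dominating_set (del_nbhd E W a) E (insert p D0)"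
        unfolding dominating_set_def W'_def[symmetric]
      proof (intro conjI ballI)
        show "insert p D0 \<subseteq> W'" using True D0 by blast
        show "\<exists>u\<in>insert p D0. {u, v} \<in> E" if "v \<in> W' - insert p D0" for v
          using lost[of v] that by blast
      qed
      have "insert c (insert e D0) \<subseteq> D" using e c D0 by blast
      then have "card (insert c (insert e D0)) \<le> card D" by (intro card_mono finD)
      moreover have "card (insert c (insert e D0)) = Suc (Suc (card D0))"
        using e D0 \<open>c \<notin> D0\<close> \<open>c \<noteq> a\<close> \<open>c \<noteq> b\<close> by (subst card_insert_disjoint) auto
      ultimately show "card (insert p D0) < card D"
        using D0(5) by (simp add: card_insert_if)
      show "independent_set (del_nbhd E W a) E (insert p D0)" if "independent_set W E D"
        unfolding independent_set_def W'_def[symmetric]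
      proof (intro conjI ballI)
        show "insert p D0 \<subseteq> W'" using True D0 by blast
        fix u v assume "u \<in> insert p D0" "v \<in> insert p D0"
        moreover have "{p, d} \<notin> E \<and> {d, p} \<notin> E" if "d \<in> D0" for d
          using True that by (auto simp: insert_commute)
        moreover have "{u, v} \<notin> E" if "u \<in> D0" "v \<in> D0"
          using that D0(1) indep[OF \<open>independent_set W E D\<close>] by blast
        ultimately show "{u, v} \<notin> E"
          using forest_no_loop[OF F, of p] by auto
      qed
    qed
  qed
qed

subsection \<open>Spherical elimination\<close>

text \<open>A relation, because the supports are free choices and the process gets stuck once it
  creates an isolated vertex. It models spherical maximal resolutions: cone steps are excluded, and
  \<open>W\<close> must be used up.\<close>

inductive spherical_depth :: "'a set set \<Rightarrow> 'a set \<Rightarrow> nat \<Rightarrow> bool" for E where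
  empty: "spherical_depth E {} 0"
| step: "support E W a \<Longrightarrow> spherical_depth E (del_nbhd E W a) n \<Longrightarrow> spherical_depth E W (Suc n)"

text \<open>An isolated vertex is neither a support nor adjacent to one, so it stays isolated at
  every step and \<open>W\<close> is never emptied.\<close>

lemma spherical_depth_not_isolated:
  assumes "spherical_depth E W n"
  shows "\<not> isolated E W v"
  using assms
proof (induction rule: spherical_depth.induct)
  case empty
  then show ?case by (simp add: isolated_def)
next
  case (step W a n)
  show ?case
  proof
    assume v: "isolated E W v"
    moreover have "v \<noteq> a" using v step(1) isolated_not_support by metis
    moreover have "{v, a} \<notin> E"
      using v support_mem[OF step(1)] by (auto simp: isolated_def nbrs_def insert_commute)
    ultimately have "isolated E (del_nbhd E W a) v"
      by (auto simp: isolated_def nbrs_def mem_del_nbhd)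
    then show False using step.IH by blast
  qed
qed

text \<open>The only neighbour \<open>a\<close> of \<open>b\<close> disappears with N[d], while
  \<open>b\<close> itself, not being adjacent to \<open>d\<close>, remains.\<close>

lemma leaf_at_isolated_del_nbhd:
  assumes "leaf_at E W b a" "b \<noteq> d" "a \<noteq> d" "{a, d} \<in> E" "d \<in> W"
  shows "isolated E (del_nbhd E W d) b"
proof -
  have "{b, d} \<notin> E" using leaf_atD(6)[OF assms(1), of d] assms(3,5) by blast
  moreover have "nbrs E (del_nbhd E W d) b \<subseteq> nbrs E W b - {a}"
    using assms(4) by (auto simp: nbrs_def mem_del_nbhd)
  ultimately show ?thesis
    using assms(1,2) by (auto simp: isolated_def leaf_at_def mem_del_nbhd)
qed

text \<open>Neither \<open>a\<close> nor \<open>b\<close> lies in N[d], since \<open>b\<close> is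
  adjacent to nothing but \<open>a\<close>. This lets two non-adjacent supports commute.\<close>

lemma leaf_at_del_nbhd:
  assumes "leaf_at E W b a" "a \<noteq> d" "{a, d} \<notin> E" "d \<in> W"
  shows "leaf_at E (del_nbhd E W d) b a"
proof -
  have "{b, d} \<notin> E" using leaf_atD(6)[OF assms(1), of d] assms(2,4) by blast
  moreover have "b \<noteq> d" using leaf_atD(3)[OF assms(1)] assms(3) by blast
  moreover have "nbrs E (del_nbhd E W d) b = nbrs E W b"
    using assms leaf_atD(5)[OF assms(1)] unfolding nbrs_def mem_del_nbhd by blast
  ultimately show ?thesis
    using assms(1) by (simp add: leaf_at_def mem_del_nbhd)
qed

text \<open>Local confluence: two supports either commute, or are the two ends of a component \<open>K\<^sub>2\<close>, or
  each isolates a leaf of the other one, which never disappears afterwards.\<close>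

lemma spherical_depth_any_support:
  assumes "spherical_depth E W n" "support E W a"
  obtains m where "n = Suc m" "spherical_depth E (del_nbhd E W a) m"
proof -
  have "\<exists>m. n = Suc m \<and> spherical_depth E (del_nbhd E W a) m"
    using assms
  proof (induction rule: spherical_depth.induct)
    case empty
    then show ?case by (simp add: support_def leaf_at_def)
  next
    case (step W d n)
    obtain b where b: "leaf_at E W b a" using step.prems by (auto simp: support_def)
    obtain b1 where b1: "leaf_at E W b1 d" using step.hyps by (auto simp: support_def)
    have W: "a \<in> W" "d \<in> W" using leaf_atD b b1 by metis+
    consider "a = d" | "a \<noteq> d" "{a, d} \<in> E" | "a \<noteq> d" "{a, d} \<notin> E" by blast
    then show ?case
    proof cases
      case 1
      then show ?thesis using step by blast
    next
      case 2
      then have "b = d"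
        using leaf_at_isolated_del_nbhd[OF b] W spherical_depth_not_isolated[OF step.hyps(2)] by blast
      then have "b1 = a" using leaf_atD[OF b] leaf_atD[OF b1] by metis
      then have "del_nbhd E W a = del_nbhd E W d"
        using b b1 \<open>b = d\<close> by (auto simp: del_nbhd_def leaf_at_def)
      then show ?thesis using step by metis
    next
      case 3
      have "support E (del_nbhd E W d) a"
        using leaf_at_del_nbhd[OF b] 3 W by (auto simp: support_def)
      \<comment> \<open>The induction hypothesis takes \<open>a\<close> right after
        \<open>d\<close>; swapping the two puts \<open>a\<close> first.\<close>
      then obtain m where m: "n = Suc m" "spherical_depth E (del_nbhd E (del_nbhd E W d) a) m"
        using step.IH by blast
      have "support E (del_nbhd E W a) d"
        using leaf_at_del_nbhd[OF b1, of a] 3 W by (auto simp: support_def insert_commute)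
      then show ?thesis using m spherical_depth.step del_nbhd_commute by metis
    qed
  qed
  then show thesis using that by blast
qed

text \<open>Induction on \<open>n\<close>: the reduction yields a support \<open>a\<close> and a
  smaller dominating set of what remains, and by confluence the depth drops by exactly one,
  whichever support was picked.\<close>

lemma spherical_depth_le_dominating:
  assumes "forest V E" "W \<subseteq> V" "spherical_depth E W n" "dominating_set W E D"
  shows "n \<le> card D"
  using assms(2-)
proof (induction n arbitrary: W D)
  case 0
  then show ?case by simp
next
  case (Suc n)
  note iso = spherical_depth_not_isolated[OF Suc.prems(2)]
  have ne: "W \<noteq> {}"
    using Suc.prems(2) by (cases rule: spherical_depth.cases) (auto dest: support_mem)
  \<comment> \<open>A leaf of \<open>c\<close> other than \<open>a\<close> would become isolated on
    removing N[a], which a spherical elimination excludes.\<close>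
  have bad: "x = a" if a: "support E W a" and c: "c \<in> nbrs E W a" and x: "leaf_at E W x c" for a c x
  proof (rule ccontr)
    assume "x \<noteq> a"
    have "c \<noteq> a" "{c, a} \<in> E" using c forest_no_loop[OF assms(1)] by (auto simp: nbrs_def)
    then have "isolated E (del_nbhd E W a) x"
      using leaf_at_isolated_del_nbhd[OF x \<open>x \<noteq> a\<close>] support_mem[OF a] by blast
    then show False
      using spherical_depth_any_support[OF Suc.prems(2) a] spherical_depth_not_isolated by metis
  qed
  obtain a D' where a: "support E W a" and D': "dominating_set (del_nbhd E W a) E D'" "card D' < card D"
    using forest_reduce_dominating[OF assms(1) Suc.prems(1) ne iso Suc.prems(3)] bad by metis
  have "spherical_depth E (del_nbhd E W a) n"
    using spherical_depth_any_support[OF Suc.prems(2) a] by auto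
  then have "n \<le> card D'"
    using Suc.IH D'(1) Suc.prems(1) del_nbhd_subset by (metis subset_trans)
  then show ?case using D' by simp
qed

subsection \<open>Elimination sequences\<close>

text \<open>The graph-theoretic counterpart of \<open>resolution\<close>; in a forest, maximality
  will mean that \<open>survivors\<close> is empty.\<close>

fun elim_seq :: "'a set set \<Rightarrow> 'a set \<Rightarrow> 'a list \<Rightarrow> bool" where
  "elim_seq E W [] \<longleftrightarrow> True"
| "elim_seq E W (a # A) \<longleftrightarrow> (isolated E W a \<or> support E W a) \<and> elim_seq E (del_nbhd E W a) A"

fun survivors :: "'a set set \<Rightarrow> 'a set \<Rightarrow> 'a list \<Rightarrow> 'a set" where
  "survivors E W [] = W"
| "survivors E W (a # A) = survivors E (del_nbhd E W a) A"

lemma elim_seq_append: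
  "elim_seq E W (A @ B) \<longleftrightarrow> elim_seq E W A \<and> elim_seq E (survivors E W A) B"
  by (induction A arbitrary: W) auto

lemma survivors_subset: "survivors E W A \<subseteq> W"
proof (induction A arbitrary: W)
  case (Cons a A)
  then show ?case using del_nbhd_subset[of E W a] by (metis subset_trans survivors.simps(2))
qed simp

text \<open>Strong induction on \<open>card D\<close>. The length is only bounded, since one step of
  the reduction may shrink \<open>D\<close> by more than one element.\<close>

lemma forest_elim_seq_le_independent_dominating:
  assumes "forest V E" "W \<subseteq> V" "independent_set W E D" "dominating_set W E D"
  shows "\<exists>A. elim_seq E W A \<and> survivors E W A = {} \<and> length A \<le> card D"
  using assms(2-)
proof (induction "card D" arbitrary: W D rule: less_induct)
  case less
  have finW: "finite W"
    using assms(1) less.prems(1) by (auto simp: forest_def simple_graph_def dest: finite_subset)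
  have DW: "D \<subseteq> W" and finD: "finite D"
    using less.prems finW by (auto simp: dominating_set_def dest: finite_subset)
  have step: ?case if a: "isolated E W a \<or> support E W a"
    and D': "independent_set (del_nbhd E W a) E D'" "dominating_set (del_nbhd E W a) E D'"
      "card D' < card D" for a D'
  proof -
    obtain A where "elim_seq E (del_nbhd E W a) A" "survivors E (del_nbhd E W a) A = {}"
      "length A \<le> card D'"
      using less.hyps[OF D'(3) _ D'(1,2)] less.prems(1) del_nbhd_subset by (metis subset_trans)
    then show ?thesis using a D'(3) by (intro exI[of _ "a # A"]) auto
  qed
  \<comment> \<open>A vertex outside N[a] is not dominated by \<open>a\<close>, so
    \<open>D - {a}\<close> dominates the rest; independence keeps \<open>D - {a}\<close> inside
    it.\<close>
  have stepD: ?case if a: "isolated E W a \<or> support E W a" "a \<in> D" for a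
  proof (rule step[OF a(1)])
    show "independent_set (del_nbhd E W a) E (D - {a})"
      using less.prems a by (auto simp: independent_set_def mem_del_nbhd)
    show "dominating_set (del_nbhd E W a) E (D - {a})"
      unfolding dominating_set_def
    proof (intro conjI ballI)
      show "D - {a} \<subseteq> del_nbhd E W a"
        using less.prems(2) a DW by (auto simp: independent_set_def mem_del_nbhd)
      fix v assume v: "v \<in> del_nbhd E W a - (D - {a})"
      then have "v \<in> W - D" "{a, v} \<notin> E" by (auto simp: mem_del_nbhd insert_commute)
      then obtain u where "u \<in> D" "{u, v} \<in> E" "u \<noteq> a"
        using less.prems(3) by (auto simp: dominating_set_def)
      then show "\<exists>u\<in>D - {a}. {u, v} \<in> E" by blast
    qed
    show "card (D - {a}) < card D"
      using a finD by (intro psubset_card_mono) auto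
  qed
  show ?case
  proof (cases "W = {} \<or> (\<exists>v. isolated E W v) \<or> (\<exists>a\<in>D. support E W a)")
    case True
    moreover have "v \<in> D" if v: "isolated E W v" for v
    proof (rule ccontr)
      assume "v \<notin> D"
      then obtain u where "u \<in> D" "{u, v} \<in> E"
        using v less.prems(3) unfolding isolated_def dominating_set_def by blast
      then show False using v DW by (auto simp: isolated_def nbrs_def)
    qed
    ultimately have "?thesis" if "W \<noteq> {}" using stepD that by blast
    moreover have "?thesis" if "W = {}" using that by (intro exI[of _ "[]"]) simp
    ultimately show ?thesis by blast
  next
    case False
    \<comment> \<open>No support lies in \<open>D\<close>, so the hypothesis of the reduction about
      leaves at some \<open>c\<close> in \<open>D\<close> holds vacuously.\<close>
    have "support E W c" if "leaf_at E W x c" for x c using that by (auto simp: support_def)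
    then obtain a D' where "support E W a" "dominating_set (del_nbhd E W a) E D'" "card D' < card D"
      "independent_set (del_nbhd E W a) E D'"
      using forest_reduce_dominating[OF assms(1) less.prems(1) _ _ less.prems(3)] False less.prems(2)
      by metis
    then show ?thesis using step by blast
  qed
qed

text \<open>This is why a maximal elimination in a forest stops only at the empty set.\<close>

lemma forest_isolated_or_support:
  assumes "forest V E" "W \<subseteq> V" "W \<noteq> {}"
  shows "\<exists>a. isolated E W a \<or> support E W a"
  using forest_deep_support[OF assms] by metis

text \<open>Ensures that the minimum defining \<open>min_depth\<close> is taken over a nonempty
  set.\<close>

lemma forest_elim_seq_exists:
  assumes "forest V E" "W \<subseteq> V"
  shows "\<exists>A. elim_seq E W A \<and> survivors E W A = {}"
  using assms(2)
proof (induction "card W" arbitrary: W rule: less_induct)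
  case less
  have finW: "finite W"
    using assms(1) less.prems by (auto simp: forest_def simple_graph_def dest: finite_subset)
  show ?case
  proof (cases "W = {}")
    case True
    then show ?thesis by (intro exI[of _ "[]"]) simp
  next
    case False
    then obtain a where a: "isolated E W a \<or> support E W a"
      using forest_isolated_or_support assms(1) less.prems by blast
    then have "a \<in> W" by (auto simp: isolated_def dest: support_mem)
    then have "del_nbhd E W a \<subset> W" by (auto simp: mem_del_nbhd)
    then obtain A where "elim_seq E (del_nbhd E W a) A" "survivors E (del_nbhd E W a) A = {}"
      using less.hyps[of "del_nbhd E W a"] less.prems psubset_card_mono[OF finW] by blast
    then show ?thesis using a by (intro exI[of _ "a # A"]) simp
  qed
qed

text \<open>Later choices lie outside N[a] for every earlier choice \<open>a\<close>, which gives
  independence and distinctness; each discarded vertex is dominated by the choice that discarded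
  it.\<close>

lemma elim_seq_dominating:
  assumes "elim_seq E W A" "survivors E W A = {}" "\<And>x. {x} \<notin> E"
  shows "independent_set W E (set A)" "dominating_set W E (set A)" "card (set A) = length A"
proof -
  have "independent_set W E (set A) \<and> dominating_set W E (set A) \<and> card (set A) = length A"
    using assms(1,2)
  proof (induction A arbitrary: W)
    case Nil
    then show ?case by (simp add: independent_set_def dominating_set_def)
  next
    case (Cons a A)
    let ?W = "del_nbhd E W a"
    have IH: "independent_set ?W E (set A)" "dominating_set ?W E (set A)" "card (set A) = length A"
      using Cons by auto
    have a: "a \<in> W" using Cons.prems support_mem by (auto simp: isolated_def)
    have A: "x \<in> W \<and> x \<noteq> a \<and> {x, a} \<notin> E \<and> {a, x} \<notin> E" if "x \<in> set A" for x
      using IH(1) that by (auto simp: independent_set_def mem_del_nbhd insert_commute)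
    \<comment> \<open>\<open>independent_set\<close> also tests \<open>u = v\<close>, so a loop at
      \<open>a\<close> has to be excluded.\<close>
    have "independent_set W E (set (a # A))"
      using IH(1) A a assms(3) by (auto simp: independent_set_def)
    moreover have "dominating_set W E (set (a # A))"
      using IH(2) A a by (auto simp: dominating_set_def mem_del_nbhd insert_commute)
    moreover have "a \<notin> set A" using A by blast
    ultimately show ?case using IH(3) by simp
  qed
  then show "independent_set W E (set A)" "dominating_set W E (set A)" "card (set A) = length A"
    by blast+
qed

subsection \<open>The ideals of a resolution\<close>

text \<open>Membership test for monomials in the ideal generated by the variables outside
  \<open>W\<close>, all squares and all edge monomials.\<close>

definition dead_monom :: "'a set set \<Rightarrow> 'a set \<Rightarrow> ('a \<Rightarrow>\<^sub>0 nat) \<Rightarrow> bool" where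
  "dead_monom E W m \<longleftrightarrow> (\<exists>z. z \<notin> W \<and> Poly_Mapping.lookup m z \<noteq> 0) \<or> (\<exists>x. Poly_Mapping.lookup m x \<ge> 2) \<or>
     (\<exists>x y. {x, y} \<in> E \<and> Poly_Mapping.lookup m x \<noteq> 0 \<and> Poly_Mapping.lookup m y \<noteq> 0)"

text \<open>For \<open>W = V - N[S]\<close> with \<open>S\<close> independent, this is the colon ideal of the edge ideal by the
  product of the variables in \<open>S\<close>.\<close>

definition live_ideal :: "'a set \<Rightarrow> 'a set set \<Rightarrow> 'a set \<Rightarrow> 'a int_mpoly set" where
  "live_ideal V E W = {p \<in> carrier (mpoly_ring V). \<forall>m\<in>Poly_Mapping.keys p. dead_monom E W m}"

text \<open>Multiplication by a monomial shifts exponents injectively, so nothing cancels;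
  \<open>keys_mult\<close> gives only one inclusion.\<close>

lemma keys_monom_mult:
  fixes p :: "'a int_mpoly"
  shows "Poly_Mapping.keys (Poly_Mapping.single k 1 * p) = (\<lambda>m. k + m) ` Poly_Mapping.keys p"
proof -
  have "Poly_Mapping.lookup (Poly_Mapping.single k 1 * p) (k + m) = Poly_Mapping.lookup p m" for m
  proof -
    have "Poly_Mapping.lookup (Poly_Mapping.single k 1 * p) (k + m) =
        (\<Sum>l. (\<Sum>q. Poly_Mapping.lookup p q when k + m = l + q) when k = l)"
      by (simp only: lookup_mult lookup_single when_mult mult_1_left)
    also have "\<dots> = (\<Sum>q. Poly_Mapping.lookup p q when k + m = k + q)" by simp
    also have "\<dots> = Poly_Mapping.lookup p m" by (simp add: eq_commute)
    finally show ?thesis .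
  qed
  moreover have "Poly_Mapping.keys (Poly_Mapping.single k 1 * p) \<subseteq> (\<lambda>m. k + m) ` Poly_Mapping.keys p"
    using keys_mult[of "Poly_Mapping.single k 1" p] by auto
  ultimately show ?thesis by (auto simp: in_keys_iff)
qed

section \<open>Ideals spanned by dead monomials\<close>

lemma dead_monom_add: "dead_monom E W m \<Longrightarrow> dead_monom E W (k + m)"
  unfolding dead_monom_def lookup_add by (metis add_is_0 trans_le_add2)

lemma mpoly_ring_simps [simp]:
  "a \<oplus>\<^bsub>mpoly_ring V\<^esub> b = a + b" "a \<otimes>\<^bsub>mpoly_ring V\<^esub> b = a * b"
  "\<zero>\<^bsub>mpoly_ring V\<^esub> = 0" "\<one>\<^bsub>mpoly_ring V\<^esub> = 1"
  by (simp_all add: mpoly_ring_def)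

lemma mem_carrier_mpoly_ring:
  "p \<in> carrier (mpoly_ring V) \<longleftrightarrow> (\<forall>m\<in>Poly_Mapping.keys p. Poly_Mapping.keys m \<subseteq> V)"
  by (simp add: mpoly_ring_def)

lemma one_in_carrier: "1 \<in> carrier (mpoly_ring V)"
  by (simp add: mem_carrier_mpoly_ring)

lemma ideal_live_ideal: "ideal (live_ideal V E W) (mpoly_ring V)"
proof -
  interpret R: cring "mpoly_ring V" by (rule cring_mpoly_ring)
  have mult: "x * a \<in> live_ideal V E W" if "a \<in> live_ideal V E W" "x \<in> carrier (mpoly_ring V)" for a x
  proof -
    have "dead_monom E W m" if "m \<in> Poly_Mapping.keys (x * a)" for m
      using that keys_mult[of x a] \<open>a \<in> live_ideal V E W\<close> dead_monom_add
      by (fastforce simp: live_ideal_def)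
    then show ?thesis using that keys_mult_subset by (auto simp: live_ideal_def)
  qed
  show ?thesis
  proof (rule idealI)
    show "ring (mpoly_ring V)" by (rule R.ring_axioms)
    show "subgroup (live_ideal V E W) (add_monoid (mpoly_ring V))"
    proof (rule R.add.subgroupI)
      show "live_ideal V E W \<subseteq> carrier (mpoly_ring V)" by (auto simp: live_ideal_def)
      have "0 \<in> live_ideal V E W" by (simp add: live_ideal_def mem_carrier_mpoly_ring)
      then show "live_ideal V E W \<noteq> {}" by blast
      show "\<ominus>\<^bsub>mpoly_ring V\<^esub> a \<in> live_ideal V E W" if "a \<in> live_ideal V E W" for a
      proof -
        have "a \<in> carrier (mpoly_ring V)" using that by (simp add: live_ideal_def)
        moreover from this have "- a \<in> carrier (mpoly_ring V)" by (simp add: mem_carrier_mpoly_ring)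
        ultimately have "\<ominus>\<^bsub>mpoly_ring V\<^esub> a = - a" by (intro R.minus_equality) auto
        then show ?thesis using that by (simp add: live_ideal_def mem_carrier_mpoly_ring)
      qed
      show "a \<oplus>\<^bsub>mpoly_ring V\<^esub> b \<in> live_ideal V E W"
        if "a \<in> live_ideal V E W" "b \<in> live_ideal V E W" for a b
        using that Poly_Mapping.keys_add[of a b]
        by (fastforce simp: live_ideal_def mem_carrier_mpoly_ring)
    qed
    show "x \<otimes>\<^bsub>mpoly_ring V\<^esub> a \<in> live_ideal V E W" "a \<otimes>\<^bsub>mpoly_ring V\<^esub> x \<in> live_ideal V E W"
      if "a \<in> live_ideal V E W" "x \<in> carrier (mpoly_ring V)" for a x
      using mult[OF that] by (simp_all add: mult.commute)
  qed
qed

lemma poly_mapping_sum_single: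
  fixes p :: "'a \<Rightarrow>\<^sub>0 'b::comm_monoid_add"
  shows "p = (\<Sum>m\<in>Poly_Mapping.keys p. Poly_Mapping.single m (Poly_Mapping.lookup p m))"
proof (rule poly_mapping_eqI)
  fix k
  have "(\<Sum>m\<in>Poly_Mapping.keys p. Poly_Mapping.lookup (Poly_Mapping.single m (Poly_Mapping.lookup p m)) k) =
      (\<Sum>m\<in>Poly_Mapping.keys p. if k = m then Poly_Mapping.lookup p m else 0)"
    by (intro sum.cong refl) (auto simp: lookup_single when_def)
  then show "Poly_Mapping.lookup p k = Poly_Mapping.lookup (\<Sum>m\<in>Poly_Mapping.keys p. Poly_Mapping.single m (Poly_Mapping.lookup p m)) k"
    by (auto simp: lookup_sum in_keys_iff)
qed

text \<open>Reduces an inclusion of ideals to monomials: a polynomial is the sum of its terms, and a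
  term lies in \<open>J\<close> once some monomial \<open>g\<close> in \<open>J\<close> divides it,
  the coefficient going into the cofactor.\<close>

lemma live_ideal_subset:
  assumes J: "ideal J (mpoly_ring V)"
    and gen: "\<And>m. Poly_Mapping.keys m \<subseteq> V \<Longrightarrow> dead_monom E W m \<Longrightarrow>
      \<exists>g k. g + k = m \<and> Poly_Mapping.single g 1 \<in> J"
  shows "live_ideal V E W \<subseteq> J"
proof
  interpret ideal J "mpoly_ring V" by (rule J)
  fix p assume p: "p \<in> live_ideal V E W"
  have "Poly_Mapping.single m c \<in> J" if m: "m \<in> Poly_Mapping.keys p" for m c
  proof -
    have mV: "Poly_Mapping.keys m \<subseteq> V" "dead_monom E W m"
      using p m by (auto simp: live_ideal_def mem_carrier_mpoly_ring)
    then obtain g k where gk: "g + k = m" "Poly_Mapping.single g 1 \<in> J" using gen by blast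
    have "Poly_Mapping.keys k \<subseteq> Poly_Mapping.keys m" unfolding gk(1)[symmetric] by (auto simp: in_keys_iff lookup_add)
    then have "Poly_Mapping.single k c \<in> carrier (mpoly_ring V)"
      using mV by (auto simp: mem_carrier_mpoly_ring)
    then show ?thesis using I_r_closed[OF gk(2), of "Poly_Mapping.single k c"] gk(1) by (simp add: mult_single)
  qed
  moreover have "(\<Sum>m\<in>M. f m) \<in> J" if "finite M" "\<And>m. m \<in> M \<Longrightarrow> f m \<in> J"
    for M and f :: "('a \<Rightarrow>\<^sub>0 nat) \<Rightarrow> 'a int_mpoly"
    using that
  proof (induction M rule: finite_induct)
    case empty
    then show ?case using additive_subgroup.zero_closed[OF ideal.axioms(1)[OF J]] by simp
  next
    case (insert x F)
    then show ?case using additive_subgroup.a_closed[OF ideal.axioms(1)[OF J], of "f x" "sum f F"] by simp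
  qed
  ultimately show "p \<in> J" by (subst poly_mapping_sum_single) simp
qed

lemma poly_mapping_split:
  fixes m :: "'a \<Rightarrow>\<^sub>0 nat"
  assumes "\<And>x. Poly_Mapping.lookup g x \<le> Poly_Mapping.lookup m x"
  shows "g + (m - g) = m"
  using assms by (intro poly_mapping_eqI) (simp add: lookup_add lookup_minus)

section \<open>Generators, adjoined variables and colons as operations on the vertex set\<close>

lemma var_mult_var:
  "var x * var y = Poly_Mapping.single (Poly_Mapping.single x 1 + Poly_Mapping.single y 1) 1"
  by (simp add: var_def mult_single)

text \<open>The edge clause with \<open>x = y = a\<close> would need a loop at \<open>a\<close>. The
  vertex set \<open>W\<close> can thus be read off from the ideal.\<close>

lemma var_mem_live_ideal:
  assumes "a \<in> V" "\<And>x. {x} \<notin> E"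
  shows "var a \<in> live_ideal V E W \<longleftrightarrow> a \<notin> W"
proof -
  have "dead_monom E W (Poly_Mapping.single a 1) \<longleftrightarrow> a \<notin> W"
    using assms(2) by (auto simp: dead_monom_def lookup_single when_def)
  then show ?thesis using assms(1) by (simp add: live_ideal_def mem_carrier_mpoly_ring var_def)
qed

text \<open>For monomials in the variables \<open>V\<close> the first clause of
  \<open>dead_monom\<close> is void when \<open>W = V\<close>, which leaves the squares and the
  edges.\<close>

lemma edge_ideal_eq_live_ideal:
  assumes "simple_graph V E"
  shows "edge_ideal V E = live_ideal V E V"
proof -
  interpret R: cring "mpoly_ring V" by (rule cring_mpoly_ring)
  let ?S = "{(var x)\<^sup>2 | x. x \<in> V} \<union> {var x * var y | x y. {x, y} \<in> E}"
  have EV: "x \<in> V \<and> y \<in> V \<and> x \<noteq> y" if "{x, y} \<in> E" for x y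
    using that assms by (fastforce simp: simple_graph_def)
  have sub: "?S \<subseteq> live_ideal V E V"
  proof -
    have "(var x)\<^sup>2 \<in> live_ideal V E V" if "x \<in> V" for x
      using that Poly_Mapping.keys_add[of "Poly_Mapping.single x 1" "Poly_Mapping.single x (1::nat)"]
      by (auto simp: power2_eq_square var_mult_var live_ideal_def mem_carrier_mpoly_ring
        dead_monom_def lookup_add intro!: exI[of _ x])
    moreover have "var x * var y \<in> live_ideal V E V" if "{x, y} \<in> E" for x y
    proof -
      have "dead_monom E V (Poly_Mapping.single x 1 + Poly_Mapping.single y 1)"
        using that unfolding dead_monom_def
        by (intro disjI2 exI[of _ x] exI[of _ y]) (simp add: lookup_add)
      then show ?thesis
        using EV[OF that] Poly_Mapping.keys_add[of "Poly_Mapping.single x 1" "Poly_Mapping.single y (1::nat)"]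
        by (auto simp: var_mult_var live_ideal_def mem_carrier_mpoly_ring)
    qed
    ultimately show ?thesis by blast
  qed
  have "live_ideal V E V \<subseteq> carrier (mpoly_ring V)" by (auto simp: live_ideal_def)
  with sub have Scarr: "?S \<subseteq> carrier (mpoly_ring V)" by blast
  have "edge_ideal V E \<subseteq> live_ideal V E V"
    unfolding edge_ideal_def by (rule R.genideal_minimal[OF ideal_live_ideal sub])
  moreover have "live_ideal V E V \<subseteq> edge_ideal V E"
  proof (rule live_ideal_subset)
    show "ideal (edge_ideal V E) (mpoly_ring V)" by (rule ideal_edge_ideal[OF assms])
    have S: "?S \<subseteq> edge_ideal V E" unfolding edge_ideal_def by (rule R.genideal_self[OF Scarr])
    fix m :: "'a \<Rightarrow>\<^sub>0 nat" assume m: "Poly_Mapping.keys m \<subseteq> V" "dead_monom E V m"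
    then consider x where "Poly_Mapping.lookup m x \<ge> 2"
      | x y where "{x, y} \<in> E" "Poly_Mapping.lookup m x \<noteq> 0" "Poly_Mapping.lookup m y \<noteq> 0"
      unfolding dead_monom_def in_keys_iff[symmetric] by blast
    then show "\<exists>g k. g + k = m \<and> Poly_Mapping.single g 1 \<in> edge_ideal V E"
    proof cases
      case 1
      then have "x \<in> V" using m(1) by (auto simp: in_keys_iff subset_iff)
      then have "var x * var x \<in> edge_ideal V E" using S by (auto simp: power2_eq_square)
      moreover have "Poly_Mapping.lookup (Poly_Mapping.single x 1 + Poly_Mapping.single x 1) z \<le> Poly_Mapping.lookup m z" for z
        using 1 by (auto simp: lookup_add lookup_single when_def)
      ultimately show ?thesis using poly_mapping_split unfolding var_mult_var by blast
    next
      case 2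
      then have "var x * var y \<in> edge_ideal V E" using S by blast
      \<comment> \<open>The ends of an edge differ, so no exponent of the product exceeds 1.\<close>
      moreover have "Poly_Mapping.lookup (Poly_Mapping.single x 1 + Poly_Mapping.single y 1) z \<le> Poly_Mapping.lookup m z" for z
        using 2 EV by (auto simp: lookup_add lookup_single when_def Suc_le_eq)
      ultimately show ?thesis using poly_mapping_split unfolding var_mult_var by blast
    qed
  qed
  ultimately show ?thesis by blast
qed

text \<open>A dead monomial for \<open>W - {a}\<close> either contains \<open>a\<close>, and is a
  multiple of \<open>var a\<close>, or is dead for \<open>W\<close> already.\<close>

lemma adjoin_live_ideal:
  assumes "a \<in> V" "\<And>x. {x} \<notin> E"
  shows "adjoin V (live_ideal V E W) a = live_ideal V E (W - {a})"
proof -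
  interpret R: cring "mpoly_ring V" by (rule cring_mpoly_ring)
  let ?S = "live_ideal V E W \<union> {var a}"
  have mono: "dead_monom E (W - {a}) m" if "dead_monom E W m" for m
    using that by (auto simp: dead_monom_def)
  have sub: "?S \<subseteq> live_ideal V E (W - {a})"
    using mono var_mem_live_ideal[OF assms, of "W - {a}"] by (auto simp: live_ideal_def)
  have Scarr: "?S \<subseteq> carrier (mpoly_ring V)"
    using var_in_carrier[OF assms(1)] by (auto simp: live_ideal_def)
  have S: "?S \<subseteq> adjoin V (live_ideal V E W) a"
    unfolding adjoin_def by (rule R.genideal_self[OF Scarr])
  have "adjoin V (live_ideal V E W) a \<subseteq> live_ideal V E (W - {a})"
    unfolding adjoin_def by (rule R.genideal_minimal[OF ideal_live_ideal sub])
  moreover have "live_ideal V E (W - {a}) \<subseteq> adjoin V (live_ideal V E W) a"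
  proof (rule live_ideal_subset)
    show "ideal (adjoin V (live_ideal V E W) a) (mpoly_ring V)"
      unfolding adjoin_def by (rule R.genideal_ideal[OF Scarr])
    fix m :: "'a \<Rightarrow>\<^sub>0 nat" assume m: "Poly_Mapping.keys m \<subseteq> V" "dead_monom E (W - {a}) m"
    show "\<exists>g k. g + k = m \<and> Poly_Mapping.single g 1 \<in> adjoin V (live_ideal V E W) a"
    proof (cases "Poly_Mapping.lookup m a = 0")
      case True
      then have "dead_monom E W m" using m(2) by (auto simp: dead_monom_def)
      then have "Poly_Mapping.single m 1 \<in> live_ideal V E W"
        using m(1) by (simp add: live_ideal_def mem_carrier_mpoly_ring)
      then show ?thesis using S by (intro exI[of _ m] exI[of _ 0]) auto
    next
      case False
      then have "Poly_Mapping.lookup (Poly_Mapping.single a 1) z \<le> Poly_Mapping.lookup m z" for z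
        by (auto simp: lookup_single when_def)
      then have "Poly_Mapping.single a 1 + (m - Poly_Mapping.single a 1) = m"
        by (rule poly_mapping_split)
      moreover have "var a \<in> adjoin V (live_ideal V E W) a" using S by blast
      ultimately show ?thesis unfolding var_def by blast
    qed
  qed
  ultimately show ?thesis by blast
qed

lemma var_mult_mem_live_ideal:
  assumes "a \<in> V" "p \<in> carrier (mpoly_ring V)"
  shows "var a * p \<in> live_ideal V E W \<longleftrightarrow>
    (\<forall>m\<in>Poly_Mapping.keys p. dead_monom E W (Poly_Mapping.single a 1 + m))"
  using keys_mult_subset[OF var_in_carrier[OF assms(1)] assms(2)]
  by (simp add: live_ideal_def var_def keys_monom_mult)

text \<open>The product of \<open>a\<close> and \<open>m\<close> gains a square if \<open>a\<close>
  divides \<open>m\<close>, and an edge if a neighbour of \<open>a\<close> does. For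
  \<open>a\<close> outside \<open>W\<close> the colon would be the whole ring.\<close>

lemma colon_live_ideal:
  assumes "a \<in> V" "a \<in> W" "\<And>x. {x} \<notin> E"
  shows "colon V (live_ideal V E W) (var a) = live_ideal V E (del_nbhd E W a)"
proof -
  have "dead_monom E W (Poly_Mapping.single a 1 + m) \<longleftrightarrow> dead_monom E (del_nbhd E W a) m" for m
  proof
    assume "dead_monom E W (Poly_Mapping.single a 1 + m)"
    then consider z where "z \<notin> W" "Poly_Mapping.lookup (Poly_Mapping.single a 1 + m) z \<noteq> 0"
      | x where "Poly_Mapping.lookup (Poly_Mapping.single a 1 + m) x \<ge> 2"
      | x y where "{x, y} \<in> E" "Poly_Mapping.lookup (Poly_Mapping.single a 1 + m) x \<noteq> 0"
          "Poly_Mapping.lookup (Poly_Mapping.single a 1 + m) y \<noteq> 0"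
      unfolding dead_monom_def by blast
    then show "dead_monom E (del_nbhd E W a) m"
    proof cases
      case 1
      then have "Poly_Mapping.lookup m z \<noteq> 0"
        using assms(2) by (auto simp: lookup_add lookup_single when_def split: if_splits)
      then show ?thesis using 1 unfolding dead_monom_def mem_del_nbhd by blast
    next
      case 2
      then have "Poly_Mapping.lookup m x \<ge> 2 \<or> x = a \<and> Poly_Mapping.lookup m a \<noteq> 0"
        by (auto simp: lookup_add lookup_single when_def split: if_splits)
      then show ?thesis unfolding dead_monom_def mem_del_nbhd by blast
    next
      case 3
      have l: "Poly_Mapping.lookup m z \<noteq> 0 \<or> z = a" if "Poly_Mapping.lookup (Poly_Mapping.single a 1 + m) z \<noteq> 0" for z
        using that by (auto simp: lookup_add lookup_single when_def split: if_splits)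
      have "\<not> (x = a \<and> y = a)" using 3 assms(3) by auto
      moreover have "{y, x} \<in> E" using 3 by (simp add: insert_commute)
      ultimately show ?thesis
        using l[OF 3(2)] l[OF 3(3)] 3(1) unfolding dead_monom_def mem_del_nbhd by blast
    qed
  next
    assume "dead_monom E (del_nbhd E W a) m"
    then consider "dead_monom E W m" | "Poly_Mapping.lookup m a \<noteq> 0" | z where "{z, a} \<in> E" "Poly_Mapping.lookup m z \<noteq> 0"
      unfolding dead_monom_def mem_del_nbhd by blast
    then show "dead_monom E W (Poly_Mapping.single a 1 + m)"
    proof cases
      case 1
      then show ?thesis by (rule dead_monom_add)
    next
      case 2
      then show ?thesis unfolding dead_monom_def by (auto simp: lookup_add intro!: exI[of _ a])
    next
      case 3
      then have "Poly_Mapping.lookup (Poly_Mapping.single a 1 + m) z \<noteq> 0"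
        "Poly_Mapping.lookup (Poly_Mapping.single a 1 + m) a \<noteq> 0" by (auto simp: lookup_add)
      then show ?thesis using 3(1) unfolding dead_monom_def by blast
    qed
  qed
  then show ?thesis
    using var_mult_mem_live_ideal[OF assms(1)] unfolding colon_def live_ideal_def[of V E "del_nbhd E W a"]
    by auto
qed

section \<open>Cones and domination read off from the graph\<close>

lemma one_notin_live_ideal: "1 \<notin> live_ideal V E W"
  by (simp add: live_ideal_def dead_monom_def)

lemma live_ideal_inject:
  assumes "\<And>x. {x} \<notin> E" "W \<subseteq> V" "W' \<subseteq> V"
  shows "live_ideal V E W = live_ideal V E W' \<longleftrightarrow> W = W'"
  using var_mem_live_ideal[OF _ assms(1)] assms(2,3) by blast

text \<open>Colon and adjunction give the ideals of W - N[a] and \<open>W - {a}\<close>, which agree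
  just when \<open>a\<close> has no neighbour.\<close>

lemma cone_apex_live_ideal:
  assumes "\<And>x. {x} \<notin> E" "W \<subseteq> V"
  shows "cone_apex V (live_ideal V E W) a \<longleftrightarrow> isolated E W a"
proof (cases "a \<in> V \<and> a \<in> W")
  case True
  have "W - {a} \<subseteq> V" "del_nbhd E W a \<subseteq> V" using assms(2) del_nbhd_subset by fast+
  then have "cone_apex V (live_ideal V E W) a \<longleftrightarrow> del_nbhd E W a = W - {a}"
    using True assms(1)
    by (simp add: cone_apex_def colon_live_ideal adjoin_live_ideal live_ideal_inject)
  also have "\<dots> \<longleftrightarrow> isolated E W a"
    using True assms(1) unfolding isolated_def del_nbhd_def nbrs_def by auto
  finally show ?thesis .
next
  case False
  have "\<not> cone_apex V (live_ideal V E W) a"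
  proof
    assume c: "cone_apex V (live_ideal V E W) a"
    \<comment> \<open>With \<open>a\<close> outside \<open>W\<close> the variable lies in the ideal,
      so the colon contains 1 while the adjunction stays proper.\<close>
    then have a: "a \<in> V" "a \<notin> W" using False by (auto simp: cone_apex_def)
    then have "1 \<in> colon V (live_ideal V E W) (var a)"
      using var_mem_live_ideal[OF a(1) assms(1)] by (simp add: colon_def one_in_carrier)
    then show False
      using c a(1) assms(1) one_notin_live_ideal by (metis adjoin_live_ideal cone_apex_def)
  qed
  then show ?thesis using False assms(2) by (auto simp: isolated_def)
qed

text \<open>Deleting \<open>a\<close> alone makes \<open>b\<close> isolated, so \<open>a\<close> was
  its one neighbour.\<close>

lemma dominates_live_ideal:
  assumes "\<And>x. {x} \<notin> E" "W \<subseteq> V" "a \<in> W"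
  shows "dominates V (live_ideal V E W) a b \<longleftrightarrow> leaf_at E W b a"
proof -
  have "W - {a} \<subseteq> V" "a \<in> V" using assms by auto
  then have "dominates V (live_ideal V E W) a b \<longleftrightarrow>
      b \<in> V \<and> \<not> isolated E W b \<and> isolated E (W - {a}) b"
    using assms by (simp add: dominates_def adjoin_live_ideal cone_apex_live_ideal)
  also have "\<dots> \<longleftrightarrow> leaf_at E W b a"
  proof
    assume "b \<in> V \<and> \<not> isolated E W b \<and> isolated E (W - {a}) b"
    then show "leaf_at E W b a" by (auto simp: isolated_def leaf_at_def nbrs_def)
  next
    assume l: "leaf_at E W b a"
    have "b \<noteq> a" using leaf_atD(3)[OF l] assms(1) by auto
    then show "b \<in> V \<and> \<not> isolated E W b \<and> isolated E (W - {a}) b"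
      using l assms(2) by (auto simp: isolated_def leaf_at_def nbrs_def)
  qed
  finally show ?thesis .
qed

section \<open>Resolutions as elimination sequences\<close>

lemma colon_mult:
  assumes "q \<in> carrier (mpoly_ring V)"
  shows "colon V I (r * q) = colon V (colon V I r) q"
  using keys_mult_subset[OF assms] by (auto simp: colon_def mult.assoc)

lemma prod_var_in_carrier:
  assumes "set A \<subseteq> V" "i \<le> length A"
  shows "(\<Prod>j<i. var (A ! j)) \<in> carrier (mpoly_ring V)"
  using assms(2)
proof (induction i)
  case 0
  then show ?case by (simp add: one_in_carrier)
next
  case (Suc i)
  then have "A ! i \<in> V" using assms(1) by (meson Suc_le_eq nth_mem subsetD)
  then show ?case using Suc by (simp add: keys_mult_subset var_in_carrier)
qed

lemma colon_seq_0: "I \<subseteq> carrier (mpoly_ring V) \<Longrightarrow> colon_seq V I A 0 = I"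
  by (auto simp: colon_seq_def colon_def)

text \<open>Allows induction on lists: the tail of a sequence is measured against
  \<open>(I : a)\<close>. The bound on \<open>i\<close> keeps every \<open>A ! j\<close> within the
  list, so that the product lies in the ring.\<close>

lemma colon_seq_Cons:
  assumes "set (a # A) \<subseteq> V" "i \<le> length A"
  shows "colon_seq V I (a # A) (Suc i) = colon_seq V (colon V I (var a)) A i"
proof -
  have "(\<Prod>j<Suc i. var ((a # A) ! j)) = var a * (\<Prod>j<i. var (A ! j))"
    by (subst prod.lessThan_Suc_shift) simp
  then show ?thesis
    using colon_mult[OF prod_var_in_carrier[of A V i], of I "var a"] assms
    by (simp add: colon_seq_def del: prod.lessThan_Suc)
qed

lemma live_ideal_subset_carrier: "live_ideal V E W \<subseteq> carrier (mpoly_ring V)"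
  by (auto simp: live_ideal_def)

lemma all_less_Suc_iff: "(\<forall>i<Suc n. P i) \<longleftrightarrow> P 0 \<and> (\<forall>i<n. P (Suc i))"
  using less_Suc_eq_0_disj by auto

text \<open>List induction: index 0 tests the head against \<open>W\<close>, and the later indices
  test the tail against \<open>(I : a)\<close>, the ideal of W - N[a].\<close>

lemma resolution_live_ideal:
  assumes "\<And>x. {x} \<notin> E" "W \<subseteq> V"
  shows "resolution V (live_ideal V E W) A \<longleftrightarrow> elim_seq E W A"
  using assms(2)
proof (induction A arbitrary: W)
  case Nil
  then show ?case by (simp add: resolution_def)
next
  case (Cons a A)
  let ?I = "live_ideal V E W" and ?W = "del_nbhd E W a"
  have W': "?W \<subseteq> V" using Cons.prems del_nbhd_subset by fast
  show ?case
  proof (cases "a \<in> W \<and> set A \<subseteq> V")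
    \<comment> \<open>Both sides fail: \<open>a\<close> outside \<open>W\<close> puts
      \<open>var a\<close> into the ideal, and a tail that leaves \<open>V\<close> is no
      resolution.\<close>
    case False
    have "\<not> resolution V ?I (a # A)"
    proof
      assume r: "resolution V ?I (a # A)"
      then have a: "a \<in> V" "set A \<subseteq> V" by (auto simp: resolution_def)
      from r have "var a \<notin> colon_seq V ?I (a # A) 0" by (auto simp: resolution_def)
      then have "a \<in> W"
        using var_mem_live_ideal[OF a(1) assms(1)] by (simp add: colon_seq_0 live_ideal_subset_carrier)
      with a False show False by blast
    qed
    moreover have "\<not> elim_seq E W (a # A)"
    proof
      assume e: "elim_seq E W (a # A)"
      then have "a \<in> W" by (auto simp: isolated_def dest: support_mem)
      moreover have "resolution V (live_ideal V E ?W) A" using e Cons.IH[OF W'] by simp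
      ultimately show False using False by (auto simp: resolution_def)
    qed
    ultimately show ?thesis by blast
  next
    case True
    then have aV: "a \<in> V" "set (a # A) \<subseteq> V" using Cons.prems by auto
    have col: "colon_seq V ?I (a # A) (Suc i) = colon_seq V (live_ideal V E ?W) A i"
      if "i < length A" for i
      using colon_seq_Cons[OF aV(2), of i ?I] colon_live_ideal[OF aV(1), of W E] that True assms(1)
      by simp
    have "resolution V ?I (a # A) \<longleftrightarrow> (cone_apex V ?I a \<or> (\<exists>b. dominates V ?I a b)) \<and>
        resolution V (live_ideal V E ?W) A"
      using aV True var_mem_live_ideal[OF aV(1) assms(1), of W]
      by (simp add: resolution_def all_less_Suc_iff colon_seq_0 live_ideal_subset_carrier col
        cong: conj_cong)
    then show ?thesis
      using Cons.IH[OF W'] True Cons.prems assms(1)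
      by (simp add: cone_apex_live_ideal dominates_live_ideal support_def)
  qed
qed

text \<open>Without cone steps no chosen vertex is isolated, so each one is a support.\<close>

lemma spherical_resolution_live_ideal:
  assumes "\<And>x. {x} \<notin> E" "W \<subseteq> V"
    and "spherical_resolution V (live_ideal V E W) A" "survivors E W A = {}"
  shows "spherical_depth E W (length A)"
  using assms(2-)
proof (induction A arbitrary: W)
  case Nil
  then show ?case by (simp add: spherical_depth.empty)
next
  case (Cons a A)
  let ?I = "live_ideal V E W" and ?W = "del_nbhd E W a"
  have W': "?W \<subseteq> V" using Cons.prems del_nbhd_subset by fast
  have r: "resolution V ?I (a # A)"
    and s: "\<And>i. i < Suc (length A) \<Longrightarrow> \<not> cone_apex V (colon_seq V ?I (a # A) i) ((a # A) ! i)"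
    using Cons.prems(2) by (auto simp: spherical_resolution_def)
  then have e: "elim_seq E W (a # A)" using resolution_live_ideal assms(1) Cons.prems(1) by blast
  have aV: "set (a # A) \<subseteq> V" using r by (auto simp: resolution_def)
  have "\<not> isolated E W a"
    using s[of 0] Cons.prems(1) assms(1)
    by (simp add: colon_seq_0 live_ideal_subset_carrier cone_apex_live_ideal)
  then have a: "support E W a" using e by simp
  have "colon_seq V ?I (a # A) (Suc i) = colon_seq V (live_ideal V E ?W) A i"
    if "i < length A" for i
    using colon_seq_Cons[OF aV, of i ?I] colon_live_ideal[of a V W E] that aV support_mem[OF a] assms(1)
    by simp
  then have "spherical_resolution V (live_ideal V E ?W) A"
    unfolding spherical_resolution_def
    using s[of "Suc _"] e resolution_live_ideal[OF assms(1) W'] by auto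
  then have "spherical_depth E ?W (length A)" using Cons.IH[OF W'] Cons.prems(3) by simp
  then show ?case using spherical_depth.step[OF a] by simp
qed

text \<open>Any extension starts in \<open>survivors\<close>; conversely, a nonempty set of
  survivors in a forest offers an isolated vertex or a support.\<close>

lemma forest_maximal_resolution:
  assumes "forest V E"
  shows "maximal_resolution V (edge_ideal V E) A \<longleftrightarrow> elim_seq E V A \<and> survivors E V A = {}"
proof -
  note nl = forest_no_loop[OF assms]
  have "edge_ideal V E = live_ideal V E V"
    using assms edge_ideal_eq_live_ideal by (auto simp: forest_def)
  then have res: "resolution V (edge_ideal V E) B \<longleftrightarrow> elim_seq E V B" for B
    using resolution_live_ideal[OF nl, of V V] by simp
  have "(\<exists>B. B \<noteq> [] \<and> elim_seq E (survivors E V A) B) \<longleftrightarrow> survivors E V A \<noteq> {}"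
  proof
    assume "\<exists>B. B \<noteq> [] \<and> elim_seq E (survivors E V A) B"
    then obtain b B where "elim_seq E (survivors E V A) (b # B)" by (metis neq_Nil_conv)
    then show "survivors E V A \<noteq> {}" by (auto simp: isolated_def dest: support_mem)
  next
    assume "survivors E V A \<noteq> {}"
    then obtain a where "elim_seq E (survivors E V A) [a]"
      using forest_isolated_or_support[OF assms survivors_subset] by auto
    then show "\<exists>B. B \<noteq> [] \<and> elim_seq E (survivors E V A) B" by blast
  qed
  then show ?thesis unfolding maximal_resolution_def res elim_seq_append by blast
qed

section \<open>Comparison of the three minima\<close>

lemma obtain_eq_Least:
  fixes f :: "'b \<Rightarrow> nat"
  assumes "P x"
  obtains y where "P y" "f y = (LEAST k. \<exists>y. P y \<and> f y = k)"
  using assms LeastI[of "\<lambda>k. \<exists>y. P y \<and> f y = k" "f x"] by blast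

theorem theorem6p4:
  fixes V :: "'a set" and E :: "'a set set"
  assumes "forest V E"
  shows "independent_domination_number V E = min_depth V (edge_ideal V E) \<and>
    (spherical V (edge_ideal V E) \<longrightarrow>
       domination_number V E = min_depth V (edge_ideal V E))"
proof -
  let ?I = "edge_ideal V E"
  note nl = forest_no_loop[OF assms]
  note max_iff = forest_maximal_resolution[OF assms]
  let ?ind = "\<lambda>S. independent_set V E S \<and> dominating_set V E S"
  have min_le: "min_depth V ?I \<le> length A" if "maximal_resolution V ?I A" for A
    unfolding min_depth_def using that by (intro Least_le) blast
  have ind_le: "independent_domination_number V E \<le> card S" if "?ind S" for S
    unfolding independent_domination_number_def using that by (intro Least_le) blast
  have dom_le: "domination_number V E \<le> card S" if "dominating_set V E S" for S
    unfolding domination_number_def using that by (intro Least_le) blast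
  have lower: "?ind (set A) \<and> card (set A) = length A" if "maximal_resolution V ?I A" for A
    using elim_seq_dominating[of E V A] that max_iff nl by blast
  have upper: "min_depth V ?I \<le> card S" if "?ind S" for S
    using forest_elim_seq_le_independent_dominating[OF assms order_refl] that max_iff min_le
    by (metis order_trans)
  obtain A0 where "maximal_resolution V ?I A0"
    using forest_elim_seq_exists[OF assms order_refl] max_iff by blast
  then obtain A where A: "maximal_resolution V ?I A" "length A = min_depth V ?I"
    using obtain_eq_Least[of "maximal_resolution V ?I" A0 length] unfolding min_depth_def by blast
  have A': "?ind (set A)" "card (set A) = min_depth V ?I" using lower A by metis+
  then obtain S where S: "?ind S" "card S = independent_domination_number V E"
    using obtain_eq_Least[of ?ind "set A" card]
    unfolding independent_domination_number_def conj_assoc by blast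
  \<comment> \<open>A minimal maximal resolution gives \<open>\<le>\<close>, a minimal independent
    dominating set gives \<open>\<ge>\<close>.\<close>
  have eq: "independent_domination_number V E = min_depth V ?I"
    using ind_le[OF A'(1)] A'(2) upper[OF S(1)] S(2) by simp
  moreover have "domination_number V E = min_depth V ?I" if sph: "spherical V ?I"
  proof -
    obtain B where B: "maximal_resolution V ?I B" "spherical_resolution V ?I B"
      using sph by (auto simp: spherical_def)
    have "?I = live_ideal V E V"
      using assms edge_ideal_eq_live_ideal by (auto simp: forest_def)
    then have depth: "spherical_depth E V (length B)"
      using spherical_resolution_live_ideal[OF nl order_refl] B max_iff by metis
    obtain D where D: "dominating_set V E D" "card D = domination_number V E"
      using obtain_eq_Least[of "dominating_set V E" "set A" card] A'(1)
      unfolding domination_number_def by blast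
    \<comment> \<open>The chain reads d \<le> \<open>length B\<close> \<le> \<gamma>(F); the
      opposite inequality holds because \<open>set A\<close> is dominating.\<close>
    have "min_depth V ?I \<le> length B" using min_le B(1) by blast
    also have "\<dots> \<le> card D"
      using spherical_depth_le_dominating[OF assms order_refl depth D(1)] .
    finally show ?thesis using dom_le[of "set A"] A' D(2) by simp
  qed
  ultimately show ?thesis by blast
qed

end
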